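(* Let $r,k,t$ be positive integers satisfying $r\ge 3$ and $k+2t\le 2r-3$. For every $\varepsilon>0$ and $\alpha>0$, there exist $n_0=n_0(r,\varepsilon,\alpha)$ and $\alpha'=\alpha'(r,\varepsilon,\alpha)>0$ (depending only on $r,\varepsilon,\alpha$) such that the following holds. Let $G$ be an $n$-vertex graph with $n\ge n_0$ and $$\delta(G)\ge\left(\frac{2r-5}{2r-3}+\varepsilon\right)n.$$ Suppose that there exists a subset $W=\{w_1,\dots,w_k\}\subseteq V(G)$ of $k$ distinct vertices such that $C(K_t,G[N(W)])\ge\alpha n^t$. Then there exists a subset $W'\subseteq W$ with $|W'|=k-1$ such that $$C(K_{t+1},G[N(W')])\ge\alpha' n^{t+1}.$$
   Context: All graphs are finite and simple; $\delta(G)$ is the minimum degree. For graphs $H,G$, $C(H,G):=|\{S\subseteq V(G): G[S]\cong H\}|$ is the number of vertex subsets inducing a copy of $H$. For $W\subseteq V(G)$, $N(W)$ denotes the common neighborhood of $W$ in $G$, i.e. the set of vertices adjacent to every vertex of $W$, with the convention $N(\emptyset)=V(G)$. $G[X]$ is the induced subgraph on $X$. *)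

theory Defs
  imports Complex_Main "Graph_Theory.Graph_Theory"
begin

text \<open>
  A finite simple graph is a \<^term>\<open>G\<close> with \<^prop>\<open>graph G\<close>: a finite, symmetric, loopless digraph
  without parallel arcs. Each undirected edge is a pair of opposite arcs, so the degree of a vertex
  is its \<^const>\<open>out_degree\<close>.
\<close>

definition min_degree :: "('a, 'b) pre_digraph \<Rightarrow> nat" where
  "min_degree G = Min (out_degree G ` verts G)"

definition common_nbhd :: "('a, 'b) pre_digraph \<Rightarrow> 'a set \<Rightarrow> 'a set" where
  "common_nbhd G W = {v \<in> verts G. \<forall>w\<in>W. v \<rightarrow>\<^bsub>G\<^esub> w}"

definition complete_graph :: "nat \<Rightarrow> (nat, nat \<times> nat) pre_digraph" where
  "complete_graph t =
     with_proj \<lparr> pverts = {..<t}, parcs = {(i, j). i < t \<and> j < t \<and> i \<noteq> j} \<rparr>"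

definition induced_copies :: "('c, 'd) pre_digraph \<Rightarrow> ('a, 'b) pre_digraph \<Rightarrow> nat" where
  "induced_copies H G = card {S. S \<subseteq> verts G \<and> digraph_iso (G \<restriction> S) H}"

lemma common_nbhd_empty: "common_nbhd G {} = verts G"
  by (simp add: common_nbhd_def)

lemma complete_graph_is_complete: "K\<^bsub>t\<^esub> (complete_graph t)"
  by (auto simp: complete_graph_def complete_digraph_pair_def)

end

theory Submission
  imports Defs
begin

text \<open>
  Fix a \<open>t\<close>-clique \<open>T\<close> in the common neighbourhood of \<open>W\<close> and give weight 1 to each vertex of \<open>W\<close> and
  weight 2 to each vertex of \<open>T\<close>, for a total of \<open>m = k + 2 t \<le> 2 r - 3\<close>. The minimum degree condition
  forces the neighbourhood of an average vertex to carry weight at least \<open>m - 2 + m \<epsilon>\<close>, while a vertex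
  that misses a vertex of \<open>T\<close> or two vertices of \<open>W\<close> sees weight at most \<open>m - 2\<close>. So at least
  \<open>m \<epsilon> n / 2\<close> vertices extend \<open>T\<close> to a \<open>(t + 1)\<close>-clique in the common neighbourhood of some
  \<open>W - {w}\<close>. Pigeonhole on \<open>w\<close> and counting each \<open>(t + 1)\<close>-clique at most \<open>t + 1\<close> times
  give the claim.
\<close>

section \<open>Induced copies of complete graphs as cliques\<close>

lemma graph_induce_subgraph:
  assumes "graph G" "finite S"
  shows "graph (G \<restriction> S)"
proof -
  interpret graph G by (rule assms)
  have "symmetric (G \<restriction> S)"
    using sym_arcs unfolding symmetric_conv by (auto simp: Ball_def Bex_def) metis
  then show ?thesis
    using assms(2) by unfold_locales (auto simp: no_loops arc_to_ends_def intro: no_multi_arcs)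
qed

text \<open>An isomorphism is injective on vertices, so the arcs between distinct numbers pull back
  to arcs between distinct vertices. Conversely, in a complete graph any numbering of the vertices
  respects adjacency.\<close>

lemma digraph_iso_complete_graph_iff:
  assumes "graph G"
  shows "digraph_iso G (complete_graph t) \<longleftrightarrow> K\<^bsub>t\<^esub> G"
proof
  interpret graph G by fact
  assume "digraph_iso G (complete_graph t)"
  then obtain f where f: "digraph_isomorphism f" and eq: "complete_graph t = app_iso f G"
    unfolding digraph_iso_def by blast
  have inj: "inj_on (iso_verts f) (verts G)"
    using f by (rule digraph_isomorphism_inj_on_verts)
  have im: "iso_verts f ` verts G = {..<t}"
    using arg_cong[OF eq, of verts] by (simp add: complete_graph_def)
  have "arcs_ends (app_iso f G) = {(i, j). i < t \<and> j < t \<and> i \<noteq> j}"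
    using arg_cong[OF eq, of arcs_ends] by (simp add: complete_graph_def)
  then have ends: "(\<lambda>(u, v). (iso_verts f u, iso_verts f v)) ` arcs_ends G
      = {(i, j). i < t \<and> j < t \<and> i \<noteq> j}"
    using arcs_ends_app_iso_eq[OF f] by simp
  have adj: "u \<rightarrow>\<^bsub>G\<^esub> v" if uv: "u \<in> verts G" "v \<in> verts G" "u \<noteq> v" for u v
  proof -
    have "iso_verts f u < t" "iso_verts f v < t"
      using im uv(1,2) by blast+
    then have "(iso_verts f u, iso_verts f v) \<in> {(i, j). i < t \<and> j < t \<and> i \<noteq> j}"
      using uv by (simp add: iso_verts_eq_iff[OF f])
    then obtain x y where xy: "x \<rightarrow>\<^bsub>G\<^esub> y" "iso_verts f u = iso_verts f x" "iso_verts f v = iso_verts f y"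
      unfolding ends[symmetric] by auto
    have "u = x" "v = y"
      using xy(2,3) iso_verts_eq_iff[OF f uv(1) adj_in_verts(1)[OF xy(1)]]
        iso_verts_eq_iff[OF f uv(2) adj_in_verts(2)[OF xy(1)]] by blast+
    with xy(1) show ?thesis
      by simp
  qed
  have "arcs_ends G = {(u, v). (u, v) \<in> verts G \<times> verts G \<and> u \<noteq> v}"
    using adj adj_in_verts adj_not_same by blast
  moreover have "card (verts G) = t"
    using card_image[OF inj] im by simp
  ultimately show "K\<^bsub>t\<^esub> G"
    using assms by (simp add: complete_digraph_def)
next
  interpret graph G by fact
  assume K: "K\<^bsub>t\<^esub> G"
  then have card: "card (verts G) = t"
    and ends: "arcs_ends G = {(u, v). u \<in> verts G \<and> v \<in> verts G \<and> u \<noteq> v}"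
    by (auto simp: complete_digraph_def)
  obtain h where h: "bij_betw h (verts G) {..<t}"
    using ex_bij_betw_finite_nat[OF finite_verts] card by (auto simp: lessThan_atLeast0)
  then have inj: "inj_on h (verts G)" and im: "h ` verts G = {..<t}"
    by (auto simp: bij_betw_def)
  \<comment> \<open>Isomorphism means equality with a relabelled digraph, and the arcs of
    \<open>complete_graph\<close> are pairs. Hence each arc becomes the pair of its renumbered ends;
    the absence of parallel arcs makes this injective.\<close>
  define f where "f = \<lparr>iso_verts = h, iso_arcs = (\<lambda>a. (h (tail G a), h (head G a))),
    iso_head = snd, iso_tail = fst\<rparr>"
  have "inj_on (iso_arcs f) (arcs G)"
    by (rule inj_onI, rule no_multi_arcs)
      (auto simp: f_def arc_to_ends_def inj_on_eq_iff[OF inj])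
  then have iso: "digraph_isomorphism f"
    using inj wf_digraph by (simp add: f_def digraph_isomorphism_def)
  have "iso_arcs f ` arcs G = (\<lambda>(u, v). (h u, h v)) ` arcs_ends G"
    by (auto simp: f_def arcs_ends_conv image_image)
  also have "\<dots> = {(i, j). i < t \<and> j < t \<and> i \<noteq> j}"
  proof (intro set_eqI iffI)
    fix p assume "p \<in> (\<lambda>(u, v). (h u, h v)) ` arcs_ends G"
    then show "p \<in> {(i, j). i < t \<and> j < t \<and> i \<noteq> j}"
      using im by (auto simp: ends inj_on_eq_iff[OF inj])
  next
    fix p assume "p \<in> {(i, j). i < t \<and> j < t \<and> i \<noteq> j}"
    then obtain i j where p: "p = (i, j)" "i \<in> h ` verts G" "j \<in> h ` verts G" "i \<noteq> j"
      unfolding im by auto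
    then obtain u v where "u \<in> verts G" "v \<in> verts G" "i = h u" "j = h v"
      by blast
    with p show "p \<in> (\<lambda>(u, v). (h u, h v)) ` arcs_ends G"
      by (auto simp: ends intro!: image_eqI[of _ _ "(u, v)"])
  qed
  finally have "complete_graph t = app_iso f G"
    using im by (simp add: complete_graph_def app_iso_def with_proj_def f_def)
  with iso show "digraph_iso G (complete_graph t)"
    unfolding digraph_iso_def by blast
qed

definition cliques :: "('a, 'b) pre_digraph \<Rightarrow> nat \<Rightarrow> 'a set \<Rightarrow> 'a set set" where
  "cliques G t X = {S. S \<subseteq> X \<and> card S = t \<and> pairwise (dominates G) S}"

lemma arcs_ends_induce_subgraph:
  "arcs_ends (G \<restriction> S) = arcs_ends G \<inter> S \<times> S"
  by (auto simp: arcs_ends_conv)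

text \<open>Removes isomorphisms from the counting: from here on only \<open>cliques\<close>, which
  are plain vertex sets, have to be counted.\<close>

lemma induced_copies_complete_graph:
  assumes "graph G" "X \<subseteq> verts G"
  shows "induced_copies (complete_graph t) (G \<restriction> X) = card (cliques G t X)"
proof -
  interpret graph G by (rule assms)
  have fin: "finite X"
    using assms(2) finite_verts by (rule finite_subset)
  have "digraph_iso ((G \<restriction> X) \<restriction> S) (complete_graph t)
      \<longleftrightarrow> card S = t \<and> pairwise (dominates G) S" if "S \<subseteq> X" for S
  proof -
    have graph: "graph ((G \<restriction> X) \<restriction> S)"
      using fin that by (intro graph_induce_subgraph assms) (auto dest: finite_subset)
    then have "digraph_iso ((G \<restriction> X) \<restriction> S) (complete_graph t) \<longleftrightarrow> K\<^bsub>t\<^esub> ((G \<restriction> X) \<restriction> S)"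
      by (rule digraph_iso_complete_graph_iff)
    also have "\<dots> \<longleftrightarrow> card S = t \<and> arcs_ends G \<inter> S \<times> S = {(u, v). u \<in> S \<and> v \<in> S \<and> u \<noteq> v}"
      using that graph
      by (auto simp: complete_digraph_def arcs_ends_induce_subgraph)
    also have "\<dots> \<longleftrightarrow> card S = t \<and> pairwise (dominates G) S"
      using adj_not_same by (auto simp: pairwise_def)
    finally show ?thesis .
  qed
  then show ?thesis
    by (auto simp: induced_copies_def cliques_def intro!: arg_cong[where f = card])
qed

section \<open>Degree counting and the vertices that extend a clique\<close>

lemma (in graph) adj_commute: "u \<rightarrow>\<^bsub>G\<^esub> v \<longleftrightarrow> v \<rightarrow>\<^bsub>G\<^esub> u"
  using arcs_ends_symmetric[OF sym_arcs] by blast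

lemma (in graph) out_degree_eq_card_nbhd:
  "out_degree G v = card {u \<in> verts G. u \<rightarrow>\<^bsub>G\<^esub> v}"
proof -
  have "inj_on (head G) (out_arcs G v)"
    by (rule inj_onI, rule no_multi_arcs) (auto simp: arc_to_ends_def)
  moreover have "head G ` out_arcs G v = {u. v \<rightarrow>\<^bsub>G\<^esub> u}"
    by (auto simp: arcs_ends_conv)
  ultimately have "out_degree G v = card {u. v \<rightarrow>\<^bsub>G\<^esub> u}"
    unfolding out_degree_def using card_image by metis
  also have "{u. v \<rightarrow>\<^bsub>G\<^esub> u} = {u \<in> verts G. u \<rightarrow>\<^bsub>G\<^esub> v}"
    using adj_commute adj_in_verts by blast
  finally show ?thesis .
qed

lemma (in graph) min_degree_le:
  assumes "v \<in> verts G"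
  shows "min_degree G \<le> card {u \<in> verts G. u \<rightarrow>\<^bsub>G\<^esub> v}"
  using assms by (auto simp: min_degree_def simp flip: out_degree_eq_card_nbhd)

text \<open>Double counting of the adjacent pairs with one end in \<open>A\<close>: grouped by that
  end, each group has at least \<open>min_degree G\<close> members.\<close>

lemma (in graph) sum_degrees_into:
  assumes "A \<subseteq> verts G"
  shows "card A * min_degree G \<le> (\<Sum>v\<in>verts G. card {a \<in> A. v \<rightarrow>\<^bsub>G\<^esub> a})"
proof -
  have fin: "finite A"
    using assms finite_verts by (rule finite_subset)
  have "card A * min_degree G = (\<Sum>a\<in>A. min_degree G)"
    by simp
  also have "\<dots> \<le> (\<Sum>a\<in>A. card {v \<in> verts G. v \<rightarrow>\<^bsub>G\<^esub> a})"
    using assms by (intro sum_mono min_degree_le) auto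
  also have "\<dots> = (\<Sum>v\<in>verts G. card {a \<in> A. v \<rightarrow>\<^bsub>G\<^esub> a})"
    using fin by (intro sum_multicount_gen[symmetric]) auto
  finally show ?thesis .
qed

text \<open>For nonempty \<open>W\<close>: the vertices adjacent to all of \<open>T\<close> and to
  all but at most one vertex of \<open>W\<close>.\<close>

definition extenders :: "('a, 'b) pre_digraph \<Rightarrow> 'a set \<Rightarrow> 'a set \<Rightarrow> 'a set" where
  "extenders G W T = {v \<in> common_nbhd G T. \<exists>w\<in>W. v \<in> common_nbhd G (W - {w})}"

text \<open>Both sides bound the total weight seen by all vertices: from below by degrees, from
  above by the full weight for extenders and 2 less for all others. The terms are arranged to avoid
  subtraction on naturals.\<close>

lemma (in graph) card_extenders:
  assumes W: "W \<subseteq> verts G" "W \<noteq> {}" and T: "T \<subseteq> verts G"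
  shows "(card W + 2 * card T) * min_degree G + 2 * card (verts G)
    \<le> (card W + 2 * card T) * card (verts G) + 2 * card (extenders G W T)"
proof -
  define m where "m = card W + 2 * card T"
  define d where "d A v = card {a \<in> A. v \<rightarrow>\<^bsub>G\<^esub> a}" for A v
  define E where "E = extenders G W T"
  have fin: "finite W" "finite T"
    using W T finite_verts finite_subset by blast+
  have E: "E \<subseteq> verts G"
    by (auto simp: E_def extenders_def common_nbhd_def)
  have le: "d A v \<le> card A" if "finite A" for A v
    unfolding d_def using that by (intro card_mono) auto
  have "d W v + 2 * d T v + 2 \<le> m + 2 * of_bool (v \<in> E)" if v: "v \<in> verts G" for v
  proof (cases "v \<in> E")
    case True
    then show ?thesis
      using le[OF fin(1), of v] le[OF fin(2), of v] by (simp add: m_def)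
  next
    case False
    then consider x where "x \<in> T" "\<not> v \<rightarrow>\<^bsub>G\<^esub> x"
      | "\<And>w. w \<in> W \<Longrightarrow> \<exists>w'\<in>W - {w}. \<not> v \<rightarrow>\<^bsub>G\<^esub> w'"
      using v by (fastforce simp: E_def extenders_def common_nbhd_def)
    then show ?thesis
    proof cases
      case 1
      then have "d T v < card T"
        unfolding d_def using fin by (intro psubset_card_mono) auto
      then show ?thesis
        using le[OF fin(1), of v] by (simp add: m_def)
    next
      case 2
      \<comment> \<open>The case assumption is used twice: at any element of \<open>W\<close> it
        yields a non-neighbour \<open>w1\<close>, and at \<open>w1\<close> it yields a second
        one.\<close>
      obtain w1 w2 where w: "w1 \<in> W" "w2 \<in> W" "w1 \<noteq> w2" "\<not> v \<rightarrow>\<^bsub>G\<^esub> w1" "\<not> v \<rightarrow>\<^bsub>G\<^esub> w2"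
        using 2 W(2) by (metis DiffD1 DiffD2 all_not_in_conv singletonI)
      then have "d W v \<le> card (W - {w1, w2})"
        unfolding d_def using fin by (intro card_mono) auto
      moreover have "card (W - {w1, w2}) + 2 = card W"
        using w fin card_mono[of W "{w1, w2}"] by (subst card_Diff_subset) auto
      ultimately show ?thesis
        using le[OF fin(2), of v] by (simp add: m_def)
    qed
  qed
  then have "(\<Sum>v\<in>verts G. d W v + 2 * d T v + 2) \<le> (\<Sum>v\<in>verts G. m + 2 * of_bool (v \<in> E))"
    by (rule sum_mono)
  also have "\<dots> = m * card (verts G) + 2 * card E"
    using E by (simp add: sum.distrib sum_distrib_left[symmetric] Int_absorb1 Int_def[symmetric])
  finally have "(\<Sum>v\<in>verts G. d W v) + 2 * (\<Sum>v\<in>verts G. d T v) + 2 * card (verts G)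
      \<le> m * card (verts G) + 2 * card E"
    unfolding sum.distrib sum_distrib_left[symmetric] by (simp add: algebra_simps)
  moreover have "m * min_degree G \<le> (\<Sum>v\<in>verts G. d W v) + 2 * (\<Sum>v\<in>verts G. d T v)"
    using sum_degrees_into[OF W(1)] sum_degrees_into[OF T]
    by (simp add: m_def d_def algebra_simps)
  ultimately show ?thesis
    by (simp add: m_def E_def)
qed

section \<open>Double counting of clique extensions\<close>

lemma (in graph) insert_in_cliques:
  assumes T: "T \<in> cliques G t (common_nbhd G W)" "finite T"
    and v: "v \<in> common_nbhd G T" "v \<in> common_nbhd G (W - {w})"
  shows "insert v T \<in> cliques G (t + 1) (common_nbhd G (W - {w}))"
proof -
  have "v \<notin> T"
    using v(1) adj_not_same by (auto simp: common_nbhd_def)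
  then show ?thesis
    using assms adj_commute by (auto simp: cliques_def common_nbhd_def pairwise_insert)
qed

text \<open>Counts pairs of a clique \<open>T\<close> and an extender \<open>v\<close>. Pigeonhole
  over the dropped vertex \<open>w\<close> costs the factor \<open>card W\<close>; passing from
  pairs to the cliques \<open>insert v T\<close> costs \<open>t + 1\<close>, one for each possible
  \<open>v\<close>.\<close>

lemma (in graph) card_cliques_extend:
  assumes W: "W \<subseteq> verts G" "W \<noteq> {}"
    and b: "\<And>T. T \<in> cliques G t (common_nbhd G W) \<Longrightarrow> b \<le> real (card (extenders G W T))"
  obtains w where "w \<in> W"
    "real (card (cliques G t (common_nbhd G W))) * b
      \<le> real (card W * (t + 1) * card (cliques G (t + 1) (common_nbhd G (W - {w}))))"
proof -
  define C where "C = cliques G t (common_nbhd G W)"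
  define D where "D w = cliques G (t + 1) (common_nbhd G (W - {w}))" for w
  define P where "P w = (SIGMA T:C. {v \<in> common_nbhd G T. v \<in> common_nbhd G (W - {w})})" for w
  have finW: "finite W"
    using W finite_verts finite_subset by blast
  have nb: "common_nbhd G X \<subseteq> verts G" for X
    by (auto simp: common_nbhd_def)
  have fin_cliques: "finite (cliques G s (common_nbhd G X))" for s X
    by (rule finite_subset[of _ "Pow (verts G)"]) (use nb in \<open>auto simp: cliques_def\<close>)
  have fin_clique: "finite S" if "S \<in> cliques G s (common_nbhd G X)" for S s X
    using that nb[of X] by (intro finite_subset[OF _ finite_verts]) (auto simp: cliques_def)
  have C: "finite T" if "T \<in> C" for T
    using that fin_clique by (auto simp: C_def)
  have "real (card C) * b \<le> (\<Sum>T\<in>C. real (card (extenders G W T)))"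
    using sum_mono[of C "\<lambda>_. b"] b by (simp add: C_def)
  also have "\<dots> = card (SIGMA T:C. extenders G W T)"
    using fin_cliques finite_subset[OF nb finite_verts]
    by (subst card_SigmaI) (auto simp: C_def extenders_def)
  \<comment> \<open>The union need not be disjoint: a vertex adjacent to all of \<open>W\<close>
    qualifies for every \<open>w\<close>. A union bound suffices.\<close>
  also have "(SIGMA T:C. extenders G W T) = (\<Union>w\<in>W. P w)"
    by (auto simp: extenders_def P_def)
  also have "real (card (\<Union>w\<in>W. P w)) \<le> real (\<Sum>w\<in>W. card (P w))"
    using card_UN_le[OF finW] of_nat_mono by blast
  finally have sum: "real (card C) * b \<le> real (\<Sum>w\<in>W. card (P w))" .
  have P: "card (P w) \<le> (t + 1) * card (D w)" for w
  proof -
    have fin: "finite S" if "S \<in> D w" for S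
      using that unfolding D_def by (rule fin_clique)
    have "v \<notin> T" if "(T, v) \<in> P w" for T v
      using that adj_not_same by (auto simp: P_def common_nbhd_def)
    \<comment> \<open>Since \<open>v\<close> lies outside \<open>T\<close>, deleting it from
      \<open>insert v T\<close> recovers \<open>T\<close>.\<close>
    then have "inj_on (\<lambda>(T, v). (insert v T, v)) (P w)"
      by (intro inj_onI) (auto dest: insert_ident[THEN iffD1, rotated 2])
    moreover have "(\<lambda>(T, v). (insert v T, v)) ` P w \<subseteq> (SIGMA S:D w. S)"
      using insert_in_cliques C by (auto simp: P_def C_def D_def)
    moreover have "finite (SIGMA S:D w. S)"
      using fin_cliques fin by (auto simp: D_def)
    ultimately have "card (P w) \<le> card (SIGMA S:D w. S)"
      by (rule card_inj_on_le)
    also have "\<dots> = (\<Sum>S\<in>D w. card S)"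
      using fin_cliques fin by (intro card_SigmaI) (auto simp: D_def)
    also have "\<dots> = (t + 1) * card (D w)"
      by (simp add: D_def cliques_def)
    finally show ?thesis .
  qed
  have "\<exists>w\<in>W. real (card C) * b \<le> real (card W * card (P w))"
  proof (rule ccontr)
    assume "\<not> ?thesis"
    then have "(\<Sum>w\<in>W. real (card W * card (P w))) < (\<Sum>w\<in>W. real (card C) * b)"
      using finW W(2) by (intro sum_strict_mono) auto
    also have "\<dots> = real (card W) * (real (card C) * b)"
      by simp
    also have "\<dots> \<le> real (card W) * real (\<Sum>w\<in>W. card (P w))"
      using sum by (rule mult_left_mono) simp
    finally show False
      by (simp add: sum_distrib_left)
  qed
  then obtain w where w: "w \<in> W" "real (card C) * b \<le> real (card W * card (P w))"
    by blast
  note w(2)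
  also have "real (card W * card (P w)) \<le> real (card W * ((t + 1) * card (D w)))"
    using P by (intro of_nat_mono mult_le_mono2)
  finally show ?thesis
    using w(1) that unfolding C_def D_def mult.assoc by blast
qed

section \<open>Explicit constants for the extension step\<close>

theorem lemma2p2:
  fixes r :: nat and \<epsilon> \<alpha> :: real
  assumes "r \<ge> 3" and "\<epsilon> > 0" and "\<alpha> > 0"
  shows "\<exists>(n\<^sub>0::nat) (\<alpha>'::real). \<alpha>' > 0 \<and>
    (\<forall>(k::nat) (t::nat) (n::nat) (G :: ('a, 'b) pre_digraph) W.
       k \<ge> 1 \<and> t \<ge> 1 \<and> k + 2 * t \<le> 2 * r - 3 \<and>
       graph G \<and> card (verts G) = n \<and> n \<ge> n\<^sub>0 \<and>
       real (min_degree G) \<ge> ((2 * real r - 5) / (2 * real r - 3) + \<epsilon>) * real n \<and>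
       W \<subseteq> verts G \<and> card W = k \<and>
       real (induced_copies (complete_graph t) (G \<restriction> common_nbhd G W)) \<ge> \<alpha> * real n ^ t
       \<longrightarrow> (\<exists>W'. W' \<subseteq> W \<and> card W' = k - 1 \<and>
             real (induced_copies (complete_graph (t + 1)) (G \<restriction> common_nbhd G W'))
               \<ge> \<alpha>' * real n ^ (t + 1)))"
\<comment> \<open>The estimates carry no lower-order error terms, so 0 serves as threshold. In the
  constant, \<open>\<epsilon> / 2\<close> comes from the number of extenders and \<open>r\<close>
  bounds the multiplicity \<open>t + 1\<close>.\<close>
proof (rule exI[of _ 0], rule exI[of _ "\<alpha> * \<epsilon> / (2 * real r)"], intro conjI allI impI; (elim conjE)?)
  show "\<alpha> * \<epsilon> / (2 * real r) > 0"
    using assms by simp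
next
  fix k t n and G :: "('a, 'b) pre_digraph" and W
  assume k: "k \<ge> 1" and m: "k + 2 * t \<le> 2 * r - 3"
    and "graph G" and n: "card (verts G) = n"
    and deg: "real (min_degree G) \<ge> ((2 * real r - 5) / (2 * real r - 3) + \<epsilon>) * real n"
    and W: "W \<subseteq> verts G" "card W = k"
    and copies: "real (induced_copies (complete_graph t) (G \<restriction> common_nbhd G W)) \<ge> \<alpha> * real n ^ t"
  interpret graph G by fact
  have copies_eq: "induced_copies (complete_graph s) (G \<restriction> common_nbhd G X)
      = card (cliques G s (common_nbhd G X))" for s X
    by (rule induced_copies_complete_graph) (auto simp: common_nbhd_def \<open>graph G\<close>)
  define q where "q = 2 * real r - 3"
  have W_ne: "W \<noteq> {}"
    using k W(2) by auto
  have q: "q > 0" "real (k + 2 * t) \<le> q"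
    using m assms(1) by (auto simp: q_def)
  have ext: "real k * \<epsilon> * real n / 2 \<le> real (card (extenders G W T))"
    if "T \<in> cliques G t (common_nbhd G W)" for T
  proof -
    define M where "M = real (k + 2 * t)"
    \<comment> \<open>The degree deficit \<open>2 / q\<close> costs \<open>2 * x\<close> in total
      weight. As \<open>M \<le> q\<close>, this is at most the \<open>2 * real n\<close> gained in
      \<open>card_extenders\<close>, which leaves the \<epsilon> term.\<close>
    define x where "x = M / q * real n"
    have T: "T \<subseteq> verts G" "card T = t"
      using that by (auto simp: cliques_def common_nbhd_def)
    have "(2 * real r - 5) / (2 * real r - 3) = 1 - 2 / q"
      using q(1) by (simp add: q_def field_simps)
    then have "M * ((1 - 2 / q + \<epsilon>) * real n) \<le> M * real (min_degree G)"
      using deg by (intro mult_left_mono) (auto simp: M_def)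
    moreover have "M * real (min_degree G) + 2 * real n
        \<le> M * real n + 2 * real (card (extenders G W T))"
      using of_nat_mono[OF card_extenders[OF W(1) W_ne T(1)], where ?'a = real]
      by (simp add: M_def W(2) T(2) n)
    moreover have "M * ((1 - 2 / q + \<epsilon>) * real n) = M * real n - 2 * x + M * (\<epsilon> * real n)"
      by (simp add: x_def algebra_simps)
    moreover have "x \<le> 1 * real n"
      unfolding x_def using q by (intro mult_right_mono) (auto simp: M_def)
    ultimately have "M * (\<epsilon> * real n) \<le> 2 * real (card (extenders G W T))"
      by argo
    \<comment> \<open>Weakening \<open>M\<close> to \<open>k\<close> lets this factor cancel the
      \<open>card W\<close> lost to pigeonhole, so the final constant is free of
      \<open>k\<close>.\<close>
    moreover have "real k * (\<epsilon> * real n) \<le> M * (\<epsilon> * real n)"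
      using assms(2) by (intro mult_right_mono) (auto simp: M_def)
    ultimately show ?thesis
      by (simp add: algebra_simps)
  qed
  from card_cliques_extend[OF W(1) W_ne ext] obtain w where w: "w \<in> W"
    and le: "real (card (cliques G t (common_nbhd G W))) * (real k * \<epsilon> * real n / 2)
      \<le> real (card W * (t + 1) * card (cliques G (t + 1) (common_nbhd G (W - {w}))))"
    by blast
  define D where "D = real (card (cliques G (t + 1) (common_nbhd G (W - {w}))))"
  have "\<alpha> * real n ^ t * (real k * \<epsilon> * real n / 2)
      \<le> real (card (cliques G t (common_nbhd G W))) * (real k * \<epsilon> * real n / 2)"
    using copies assms(2) unfolding copies_eq by (intro mult_right_mono) auto
  also have "\<dots> \<le> real (card W) * real (t + 1) * D"
    using le by (simp only: D_def of_nat_mult)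
  finally have "\<alpha> * real n ^ t * (real k * \<epsilon> * real n / 2) \<le> real (card W) * real (t + 1) * D" .
  then have "real k * (\<alpha> * \<epsilon> / 2 * real n ^ (t + 1)) \<le> real k * (real (t + 1) * D)"
    by (simp only: W(2) power_add power_one_right ac_simps times_divide_eq_left times_divide_eq_right)
  then have "\<alpha> * \<epsilon> / 2 * real n ^ (t + 1) \<le> real (t + 1) * D"
    using k by (subst (asm) mult_le_cancel_left_pos) auto
  \<comment> \<open>From \<open>k \<ge> 1\<close> and \<open>k + 2 * t \<le> 2 * r - 3\<close>
    follows \<open>t + 2 \<le> r\<close>.\<close>
  also have "\<dots> \<le> real r * D"
    using m k by (intro mult_right_mono) (auto simp: D_def)
  finally have "\<alpha> * \<epsilon> / (2 * real r) * real n ^ (t + 1) \<le> D"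
    using assms(1) by (simp add: field_simps)
  moreover have "card (W - {w}) = k - 1"
    using w W(2) by simp
  ultimately show "\<exists>W'. W' \<subseteq> W \<and> card W' = k - 1 \<and>
      real (induced_copies (complete_graph (t + 1)) (G \<restriction> common_nbhd G W'))
        \<ge> \<alpha> * \<epsilon> / (2 * real r) * real n ^ (t + 1)"
    unfolding copies_eq D_def by blast
qed

end
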